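(* Let $D=(V,E)$ be a finite directed graph with two distinct distinguished vertices $b$ and $r$ such that from every vertex there is a directed path to at least one of $b,r$. Suppose Blue and Red play the Richman game on $D$ with the token initially located at vertex $v$. Let $R(v,t)$ ($t\in\{0,1,2,\dots\}$) be the auxiliary function defined in the context. (1) If Blue's share of the total money supply exceeds $R(v)=\lim_{t\to\infty}R(v,t)$, then Blue has a winning strategy. (2) Moreover, his victory will require at most $t$ moves if his share of the total money supply exceeds $R(v,t)$ (that is, in that case Blue has a strategy guaranteeing that he wins within at most $t$ moves of the token).
   Context: Richman game on $D$: two players, Blue and Red, each have a nonnegative real amount of money, the total being positive. A token rests on a vertex of $D$. On each turn, both players simultaneously and secretly bid a nonnegative real number no larger than the amount of money they currently have; the bids are then revealed. The higher bidder pays the amount of his or her bid to the opponent and moves the token from its current vertex along an arc of $D$ to a successor vertex of his or her choice. If the bids are equal, a fair coin toss decides who is treated as the higher bidder. The game ends when the token reaches $b$ (Blue wins) or $r$ (Red wins); a token located at $b$ (resp. $r$) at the start means that Blue (resp. Red) has already won. If neither $b$ nor $r$ is ever reached, the game is a draw. Money has no value at the end of the game. A player's share of the total money supply is the player's money divided by the total money of the two players. A winning strategy for a player is a policy for bidding and moving (given the initial data: the token's position, and the amounts of money of both players) that guarantees that player the victory, whatever the opponent does and whatever the coin tosses. Auxiliary function: for $v\in V$ let $S(v)=\{w\in V:(v,w)\in E\}$. Define $R(b,t)=0$ and $R(r,t)=1$ for all $t\in\{0,1,2,\dots\}$; for $v\notin\{b,r\}$ define $R(v,0)=1$ and, for $t>0$,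 $R(v,t)=\frac12\left(\max_{w\in S(v)}R(w,t-1)+\min_{u\in S(v)}R(u,t-1)\right)$. For each $v$ the sequence $R(v,t)$ is weakly decreasing in $t$ and bounded below by $0$, so the limit $R(v)$ exists. *)

theory Defs
  imports "HOL-Analysis.Analysis" "Graph_Theory.Pair_Digraph"
begin

section \<open>The auxiliary function\<close>

definition succs :: "'v pair_pre_digraph \<Rightarrow> 'v \<Rightarrow> 'v set" where
  "succs D v = {w \<in> pverts D. (v, w) \<in> parcs D}"

primrec richman :: "'v pair_pre_digraph \<Rightarrow> 'v \<Rightarrow> 'v \<Rightarrow> 'v \<Rightarrow> nat \<Rightarrow> real" where
  "richman D b r v 0 = (if v = b then 0 else 1)"
| "richman D b r v (Suc t) =
     (if v = b then 0 else if v = r then 1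
      else (Max ((\<lambda>w. richman D b r w t) ` succs D v) +
            Min ((\<lambda>u. richman D b r u t) ` succs D v)) / 2)"

definition richman_limit :: "'v pair_pre_digraph \<Rightarrow> 'v \<Rightarrow> 'v \<Rightarrow> 'v \<Rightarrow> real" where
  "richman_limit D b r v = lim (\<lambda>t. richman D b r v t)"


section \<open>Positions, turns and histories\<close>

datatype player = Blue | Red

primrec opponent :: "player \<Rightarrow> player" where
  "opponent Blue = Red"
| "opponent Red = Blue"

text \<open>The vertex carrying the token, and the money of each player.\<close>
type_synonym 'v position = "'v \<times> (player \<Rightarrow> real)"

text \<open>The two bids, the player who pays and moves, and the successor that player chose.\<close>
type_synonym 'v turn = "(player \<Rightarrow> real) \<times> player \<times> 'v"

fun after_turn :: "'v position \<Rightarrow> 'v turn \<Rightarrow> 'v position" where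
  "after_turn (v, m) (\<beta>, q, w) = (w, \<lambda>p. if p = q then m p - \<beta> q else m p + \<beta> q)"

text \<open>Histories list the completed turns, the earliest first.\<close>
definition position_after :: "'v position \<Rightarrow> 'v turn list \<Rightarrow> 'v position" where
  "position_after s h = foldl after_turn s h"

definition token :: "'v position \<Rightarrow> 'v turn list \<Rightarrow> 'v" where
  "token s h = fst (position_after s h)"

definition money :: "'v position \<Rightarrow> 'v turn list \<Rightarrow> player \<Rightarrow> real" where
  "money s h = snd (position_after s h)"

definition game_over :: "'v \<Rightarrow> 'v \<Rightarrow> 'v position \<Rightarrow> 'v turn list \<Rightarrow> bool" where
  "game_over b r s h \<longleftrightarrow> token s h \<in> {b, r}"

inductive legal_history ::
  "'v pair_pre_digraph \<Rightarrow> 'v \<Rightarrow> 'v \<Rightarrow> 'v position \<Rightarrow> 'v turn list \<Rightarrow> bool"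
  for D b r s where
  start: "legal_history D b r s []"
| turn: "\<lbrakk>legal_history D b r s h; \<not> game_over b r s h;
          \<And>p. 0 \<le> \<beta> p \<and> \<beta> p \<le> money s h p;
          \<And>p. \<beta> p \<le> \<beta> q; w \<in> succs D (token s h)\<rbrakk>
         \<Longrightarrow> legal_history D b r s (h @ [(\<beta>, q, w)])"


section \<open>Strategies and plays\<close>

text \<open>
  A strategy sees the history (and hence, knowing the initial position, the current one).
  The bid is fixed before the current bids are revealed, the move is chosen afterwards;
  the move is used only on turns in which the player is treated as the higher bidder.
\<close>
record 'v strategy =
  bid :: "'v turn list \<Rightarrow> real"
  move :: "'v turn list \<Rightarrow> (player \<Rightarrow> real) \<Rightarrow> 'v"

definition legal_strategy ::
  "'v pair_pre_digraph \<Rightarrow> 'v \<Rightarrow> 'v \<Rightarrow> 'v position \<Rightarrow> player \<Rightarrow> 'v strategy \<Rightarrow> bool" where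
  "legal_strategy D b r s p \<sigma> \<longleftrightarrow>
     (\<forall>h. legal_history D b r s h \<and> \<not> game_over b r s h \<longrightarrow>
          0 \<le> bid \<sigma> h \<and> bid \<sigma> h \<le> money s h p \<and>
          (\<forall>\<beta>. move \<sigma> h \<beta> \<in> succs D (token s h)))"

text \<open>The last argument is the player favoured by the coin in case of a tie.\<close>
definition higher_bidder :: "(player \<Rightarrow> real) \<Rightarrow> player \<Rightarrow> player" where
  "higher_bidder \<beta> c =
     (if \<beta> Blue > \<beta> Red then Blue else if \<beta> Red > \<beta> Blue then Red else c)"

text \<open>
  The history after at most \<open>n\<close> turns when both players follow the strategies \<open>\<sigma>\<close>
  and \<open>c\<close> lists the outcomes of the coin tosses; it stops growing once the game has ended.
\<close>
primrec play :: "'v \<Rightarrow> 'v \<Rightarrow> 'v position \<Rightarrow> (player \<Rightarrow> 'v strategy) \<Rightarrow>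
                  (nat \<Rightarrow> player) \<Rightarrow> nat \<Rightarrow> 'v turn list" where
  "play b r s \<sigma> c 0 = []"
| "play b r s \<sigma> c (Suc n) =
     (let h = play b r s \<sigma> c n;
          \<beta> = (\<lambda>p. bid (\<sigma> p) h);
          q = higher_bidder \<beta> (c n)
      in if game_over b r s h then h else h @ [(\<beta>, q, move (\<sigma> q) h \<beta>)])"

definition goal :: "'v \<Rightarrow> 'v \<Rightarrow> player \<Rightarrow> 'v" where
  "goal b r p = (case p of Blue \<Rightarrow> b | Red \<Rightarrow> r)"

definition winning_strategy ::
  "'v pair_pre_digraph \<Rightarrow> 'v \<Rightarrow> 'v \<Rightarrow> 'v position \<Rightarrow> player \<Rightarrow> 'v strategy \<Rightarrow> bool" where
  "winning_strategy D b r s p \<sigma> \<longleftrightarrow>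
     legal_strategy D b r s p \<sigma> \<and>
     (\<forall>\<tau> c. legal_strategy D b r s (opponent p) \<tau> \<longrightarrow>
        (\<exists>n. token s (play b r s ((\<lambda>_. \<tau>)(p := \<sigma>)) c n) = goal b r p))"

definition winning_strategy_within ::
  "'v pair_pre_digraph \<Rightarrow> 'v \<Rightarrow> 'v \<Rightarrow> 'v position \<Rightarrow> player \<Rightarrow> nat \<Rightarrow> 'v strategy \<Rightarrow> bool" where
  "winning_strategy_within D b r s p t \<sigma> \<longleftrightarrow>
     legal_strategy D b r s p \<sigma> \<and>
     (\<forall>\<tau> c. legal_strategy D b r s (opponent p) \<tau> \<longrightarrow>
        (\<exists>n\<le>t. token s (play b r s ((\<lambda>_. \<tau>)(p := \<sigma>)) c n) = goal b r p))"

definition money_share :: "(player \<Rightarrow> real) \<Rightarrow> player \<Rightarrow> real" where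
  "money_share m p = m p / (m Blue + m Red)"


section \<open>Existence of the limit\<close>

lemma succs_nonempty:
  assumes "pair_fin_digraph D"
    and "\<And>u. u \<in> pverts D \<Longrightarrow> u \<rightarrow>\<^sup>*\<^bsub>with_proj D\<^esub> b \<or> u \<rightarrow>\<^sup>*\<^bsub>with_proj D\<^esub> r"
    and "v \<in> pverts D" "v \<noteq> b" "v \<noteq> r"
  shows "succs D v \<noteq> {}"
proof -
  interpret pair_fin_digraph D by fact
  obtain x where x: "(v, x) \<in> rtrancl_on (pverts D) (parcs D)" "x \<noteq> v"
    using assms(2-5) by (auto simp: reachable_def)
  from x have "\<exists>w. (v, w) \<in> parcs D"
    by (induction rule: rtrancl_on.induct) auto
  then show ?thesis
    by (auto simp: succs_def dest: in_arcsD2)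
qed

lemma richman_bounds_mono:
  assumes D: "pair_fin_digraph D"
    and path: "\<And>u. u \<in> pverts D \<Longrightarrow> u \<rightarrow>\<^sup>*\<^bsub>with_proj D\<^esub> b \<or> u \<rightarrow>\<^sup>*\<^bsub>with_proj D\<^esub> r"
    and v: "v \<in> pverts D"
  shows "0 \<le> richman D b r v t \<and> richman D b r v t \<le> 1 \<and>
         richman D b r v (Suc t) \<le> richman D b r v t"
  using v
proof (induction t arbitrary: v)
  case (0 v)
  interpret pair_fin_digraph D by fact
  have fin: "finite (succs D v)"
    using pair_finite_verts by (auto simp: succs_def)
  show ?case
  proof (cases "v = b \<or> v = r")
    case False
    then have ne: "succs D v \<noteq> {}"
      using succs_nonempty[OF D path 0] by blast
    let ?A = "(\<lambda>w. richman D b r w 0) ` succs D v"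
    have A: "finite ?A" "?A \<noteq> {}" using fin ne by auto
    have "Max ?A \<le> 1" "Min ?A \<le> 1"
      using Max_in[OF A] Min_in[OF A] by auto
    then show ?thesis using False by simp
  qed auto
next
  case (Suc t v)
  interpret pair_fin_digraph D by fact
  have fin: "finite (succs D v)"
    using pair_finite_verts by (auto simp: succs_def)
  show ?case
  proof (cases "v = b \<or> v = r")
    case False
    then have ne: "succs D v \<noteq> {}"
      using succs_nonempty[OF D path Suc.prems] by blast
    let ?f = "\<lambda>t w. richman D b r w t"
    have IH: "0 \<le> ?f t w" "?f t w \<le> 1" "?f (Suc t) w \<le> ?f t w" if "w \<in> succs D v" for w
      using Suc.IH[of w] that by (auto simp: succs_def)
    have fi: "finite (?f k ` succs D v)" "?f k ` succs D v \<noteq> {}" for k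
      using fin ne by auto
    have "0 \<le> Max (?f t ` succs D v)" "Max (?f t ` succs D v) \<le> 1"
      using Max_in[OF fi[of t]] IH by auto
    moreover have "0 \<le> Min (?f t ` succs D v)" "Min (?f t ` succs D v) \<le> 1"
      using Min_in[OF fi[of t]] IH by auto
    moreover have "Max (?f (Suc t) ` succs D v) \<le> Max (?f t ` succs D v)"
    proof (rule Max.boundedI[OF fi])
      fix a assume "a \<in> ?f (Suc t) ` succs D v"
      then obtain w where w: "w \<in> succs D v" "a = ?f (Suc t) w" by blast
      have "a \<le> ?f t w" using IH(3) w by blast
      also have "\<dots> \<le> Max (?f t ` succs D v)" using fi w by (intro Max_ge) auto
      finally show "a \<le> Max (?f t ` succs D v)" .
    qed
    moreover have "Min (?f (Suc t) ` succs D v) \<le> Min (?f t ` succs D v)"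
    proof (rule Min.boundedI[OF fi])
      fix a assume "a \<in> ?f t ` succs D v"
      then obtain w where w: "w \<in> succs D v" "a = ?f t w" by blast
      have "Min (?f (Suc t) ` succs D v) \<le> ?f (Suc t) w"
        using fi(1)[of "Suc t"] w by (intro Min_le) auto
      also have "\<dots> \<le> a" using IH(3) w by blast
      finally show "Min (?f (Suc t) ` succs D v) \<le> a" .
    qed
    moreover have R: "?f (Suc k) v = (Max (?f k ` succs D v) + Min (?f k ` succs D v)) / 2" for k
      using False by simp
    ultimately show ?thesis
      unfolding R by auto
  qed auto
qed

lemma richman_tendsto_limit:
  assumes "pair_fin_digraph D"
    and "\<And>u. u \<in> pverts D \<Longrightarrow> u \<rightarrow>\<^sup>*\<^bsub>with_proj D\<^esub> b \<or> u \<rightarrow>\<^sup>*\<^bsub>with_proj D\<^esub> r"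
    and "v \<in> pverts D"
  shows "(\<lambda>t. richman D b r v t) \<longlonglongrightarrow> richman_limit D b r v"
proof -
  note B = richman_bounds_mono[OF assms]
  have "decseq (\<lambda>t. richman D b r v t)"
    using B by (intro decseq_SucI) blast
  moreover have "\<And>t. 0 \<le> richman D b r v t"
    using B by blast
  ultimately have "convergent (\<lambda>t. richman D b r v t)"
    by (metis decseq_convergent convergentI)
  then show ?thesis
    by (simp add: richman_limit_def convergent_LIMSEQ_iff)
qed

end

theory Submission
  imports Defs
begin

text \<open>
  Blue's fortune is measured against \<open>R(u, k)\<close>, the share that suffices to win from \<open>u\<close>
  within \<open>k\<close> turns. Suppose that the token is at a vertex \<open>u\<close> other than \<open>b\<close> and \<open>r\<close> and that
  Blue's share exceeds \<open>R(u, k + 1) = (M + \<mu>) / 2\<close>, where \<open>M\<close> and \<open>\<mu>\<close> are the largest and the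
  smallest value of \<open>R(w, k)\<close> over the successors \<open>w\<close> of \<open>u\<close>. Blue bids the fraction
  \<open>(M - \<mu>) / 2\<close> of the total money, which he can afford because \<open>\<mu> \<ge> 0\<close>. If he is the higher
  bidder, he pays this fraction, keeps a share above \<open>\<mu>\<close>, and moves to a successor with value
  \<open>\<mu>\<close>. If Red is the higher bidder, Red pays at least this fraction, so Blue's share rises above
  \<open>M\<close>, and hence above \<open>R(w, k)\<close> for every successor \<open>w\<close> that Red may choose. A tie is
  harmless since both cases cover it. So after each turn Blue's share still exceeds the value of
  the new vertex with one turn fewer remaining (\<open>winning_share_preserved\<close>).

  When no turns remain, the value is \<open>1\<close> everywhere except at \<open>b\<close>. No share exceeds \<open>1\<close>, so the
  token must have reached \<open>b\<close>. The same argument excludes \<open>r\<close> at all earlier times. This proves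
  the second part. The first part follows from it, because a share above the limit of the
  sequence \<open>R(v, t)\<close> is above one of its terms.
\<close>

section \<open>Histories and plays\<close>

lemma token_Nil [simp]: "token (v, m) [] = v"
  and money_Nil [simp]: "money (v, m) [] = m"
  by (simp_all add: token_def money_def position_after_def)

lemma token_snoc [simp]: "token s (h @ [(\<beta>, q, w)]) = w"
  by (cases "position_after s h") (simp add: token_def position_after_def)

lemma money_snoc [simp]:
  "money s (h @ [(\<beta>, q, w)]) = (\<lambda>p. if p = q then money s h p - \<beta> q else money s h p + \<beta> q)"
  by (cases "foldl after_turn s h") (auto simp: money_def position_after_def)

lemma token_in_pverts:
  assumes "legal_history D b r (v, m) h" "v \<in> pverts D"
  shows "token (v, m) h \<in> pverts D"
  using assms by induction (auto simp: succs_def)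

lemma money_nonneg:
  assumes "legal_history D b r (v, m) h" "\<And>p. 0 \<le> m p"
  shows "0 \<le> money (v, m) h p"
  using assms
proof (induction arbitrary: p)
  case (turn h \<beta> q w)
  then show ?case
    by (auto simp: add_nonneg_nonneg)
qed simp

lemma money_total:
  assumes "legal_history D b r (v, m) h"
  shows "money (v, m) h Blue + money (v, m) h Red = m Blue + m Red"
  using assms
proof induction
  case (turn h \<beta> q w)
  then show ?case by (cases q) auto
qed simp

lemma bid_le_higher_bidder: "\<beta> p \<le> \<beta> (higher_bidder \<beta> c)"
  by (cases p; cases c) (auto simp: higher_bidder_def)

lemma legal_play:
  assumes "\<And>p. legal_strategy D b r s p (\<sigma> p)"
  shows "legal_history D b r s (play b r s \<sigma> c n)"
proof (induction n)
  case 0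
  show ?case by (simp add: legal_history.start)
next
  case (Suc n)
  define h where "h = play b r s \<sigma> c n"
  define \<beta> where "\<beta> = (\<lambda>p. bid (\<sigma> p) h)"
  have h: "legal_history D b r s h"
    using Suc by (simp add: h_def)
  show ?case
  proof (cases "game_over b r s h")
    case True
    then show ?thesis using Suc by (simp add: h_def Let_def)
  next
    case False
    have leg: "0 \<le> \<beta> p \<and> \<beta> p \<le> money s h p" "move (\<sigma> p) h \<beta> \<in> succs D (token s h)" for p
      using assms[of p] h False by (auto simp: legal_strategy_def \<beta>_def)
    have "legal_history D b r s
            (h @ [(\<beta>, higher_bidder \<beta> (c n), move (\<sigma> (higher_bidder \<beta> (c n))) h \<beta>)])"
      using h False leg bid_le_higher_bidder by (intro legal_history.turn) auto
    then show ?thesis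
      using False by (simp add: h_def[symmetric] \<beta>_def[symmetric] Let_def)
  qed
qed

lemma winning_strategy_within_imp_winning_strategy:
  "winning_strategy_within D b r s p t \<sigma> \<Longrightarrow> winning_strategy D b r s p \<sigma>"
  unfolding winning_strategy_within_def winning_strategy_def by blast

section \<open>The Richman bid\<close>

text \<open>
  Half the spread of the values \<open>R(w, k)\<close> over the successors: the amount that separates the
  average of the extreme values from either of them.
\<close>
definition richman_bid :: "'v pair_pre_digraph \<Rightarrow> 'v \<Rightarrow> 'v \<Rightarrow> nat \<Rightarrow> 'v \<Rightarrow> real" where
  "richman_bid D b r k u =
     (Max ((\<lambda>w. richman D b r w k) ` succs D u) - Min ((\<lambda>w. richman D b r w k) ` succs D u)) / 2"

text \<open>
  With \<open>t\<close> turns in all, \<open>t - Suc (length h)\<close> of them remain after the one to be played at \<open>h\<close>.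
  Legality concerns every history, including those in which Blue has deviated from this strategy
  and may be too poor for the Richman bid, so the bid is capped by Blue's money.
\<close>
definition blue_strategy ::
  "'v pair_pre_digraph \<Rightarrow> 'v \<Rightarrow> 'v \<Rightarrow> 'v position \<Rightarrow> nat \<Rightarrow> 'v strategy" where
  "blue_strategy D b r s t =
     \<lparr>bid = (\<lambda>h. min (money s h Blue)
               ((snd s Blue + snd s Red) * richman_bid D b r (t - Suc (length h)) (token s h))),
      move = (\<lambda>h \<beta>. arg_min_on (\<lambda>w. richman D b r w (t - Suc (length h)))
                       (succs D (token s h)))\<rparr>"

locale richman_graph =
  fixes D :: "'v pair_pre_digraph" and b r :: 'v
  assumes fin_digraph: "pair_fin_digraph D"
    and path: "\<And>u. u \<in> pverts D \<Longrightarrow> u \<rightarrow>\<^sup>*\<^bsub>with_proj D\<^esub> b \<or> u \<rightarrow>\<^sup>*\<^bsub>with_proj D\<^esub> r"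
begin

lemma finite_succs: "finite (succs D u)"
  using pair_fin_digraph.pair_finite_verts[OF fin_digraph] by (auto simp: succs_def)

lemma succs_not_empty:
  "u \<in> pverts D \<Longrightarrow> u \<noteq> b \<Longrightarrow> u \<noteq> r \<Longrightarrow> succs D u \<noteq> {}"
  using succs_nonempty[OF fin_digraph path] by blast

lemma richman_le_Max:
  "w \<in> succs D u \<Longrightarrow> richman D b r w k \<le> Max ((\<lambda>w. richman D b r w k) ` succs D u)"
  using finite_succs by auto

lemma Min_richman_le:
  "w \<in> succs D u \<Longrightarrow> Min ((\<lambda>w. richman D b r w k) ` succs D u) \<le> richman D b r w k"
  using finite_succs by auto

lemma richman_arg_min:
  assumes "succs D u \<noteq> {}"
  shows "richman D b r (arg_min_on (\<lambda>w. richman D b r w k) (succs D u)) k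
           = Min ((\<lambda>w. richman D b r w k) ` succs D u)"
  using arg_min_if_finite[OF finite_succs assms, of "\<lambda>w. richman D b r w k"] finite_succs assms
  by (intro Min_eqI[symmetric]) (auto simp: not_less)

text \<open>
  The affordability of the Richman bid: the smaller of the two extreme values is nonnegative, so
  half their spread is at most their average.
\<close>
lemma richman_bid_bounds:
  assumes "u \<in> pverts D" "u \<noteq> b" "u \<noteq> r"
  shows "0 \<le> richman_bid D b r k u" "richman_bid D b r k u \<le> richman D b r u (Suc k)"
proof -
  let ?A = "(\<lambda>w. richman D b r w k) ` succs D u"
  obtain w where w: "w \<in> succs D u"
    using succs_not_empty[OF assms] by blast
  then show "0 \<le> richman_bid D b r k u"
    using richman_le_Max[OF w, of k] Min_richman_le[OF w, of k] by (simp add: richman_bid_def)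
  have "0 \<le> richman D b r x k" if "x \<in> succs D u" for x
    using richman_bounds_mono[OF fin_digraph path, of x k] that by (auto simp: succs_def)
  then have "0 \<le> Min ?A"
    using finite_succs w by (subst Min_ge_iff) auto
  then show "richman_bid D b r k u \<le> richman D b r u (Suc k)"
    using assms by (simp add: richman_bid_def field_simps)
qed

text \<open>
  This and the next lemma are the reason for the size of the Richman bid: paying it costs
  exactly the descent from the value of \<open>u\<close> to that of a best successor, and receiving it makes up
  for the ascent to a worst one.
\<close>
lemma richman_minus_bid:
  assumes "u \<noteq> b" "u \<noteq> r" "succs D u \<noteq> {}"
  shows "richman D b r (arg_min_on (\<lambda>w. richman D b r w k) (succs D u)) k
           = richman D b r u (Suc k) - richman_bid D b r k u"
  using assms by (simp add: richman_arg_min richman_bid_def field_simps)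

lemma richman_le_plus_bid:
  assumes "u \<noteq> b" "u \<noteq> r" "w \<in> succs D u"
  shows "richman D b r w k \<le> richman D b r u (Suc k) + richman_bid D b r k u"
  using assms richman_le_Max[OF assms(3), of k] by (simp add: richman_bid_def field_simps)

lemma legal_blue_strategy:
  assumes v: "v \<in> pverts D" and m: "\<And>p. 0 \<le> m p"
  shows "legal_strategy D b r (v, m) Blue (blue_strategy D b r (v, m) t)"
  unfolding legal_strategy_def
proof (intro allI impI, elim conjE)
  fix h assume h: "legal_history D b r (v, m) h" "\<not> game_over b r (v, m) h"
  let ?u = "token (v, m) h"
  have u: "?u \<in> pverts D" "?u \<noteq> b" "?u \<noteq> r"
    using token_in_pverts[OF h(1) v] h(2) by (auto simp: game_over_def)
  show "0 \<le> bid (blue_strategy D b r (v, m) t) h \<and>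
        bid (blue_strategy D b r (v, m) t) h \<le> money (v, m) h Blue \<and>
        (\<forall>\<beta>. move (blue_strategy D b r (v, m) t) h \<beta> \<in> succs D ?u)"
    using money_nonneg[OF h(1) m] richman_bid_bounds(1)[OF u] m[of Blue] m[of Red]
      arg_min_if_finite(1)[OF finite_succs succs_not_empty[OF u]]
    by (simp add: blue_strategy_def)
qed

section \<open>Preservation of a winning share\<close>

text \<open>
  The capping in Blue's strategy is inactive as long as the hypothesis \<open>rich\<close> holds. The bids
  here may be tied, and then either player may be the one who pays and moves.
\<close>
lemma winning_share_preserved:
  fixes m :: "player \<Rightarrow> real"
  defines "T \<equiv> m Blue + m Red"
  assumes T: "0 \<le> T"
    and u: "u \<in> pverts D" "u \<noteq> b" "u \<noteq> r" "u = token (v, m) h"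
    and rich: "T * richman D b r u (Suc k) < money (v, m) h Blue"
    and k: "k = t - Suc (length h)"
    and blue_bid: "\<beta> Blue = bid (blue_strategy D b r (v, m) t) h"
    and higher: "\<beta> Blue \<le> \<beta> q"
    and w: "w \<in> succs D u" "q = Blue \<Longrightarrow> w = move (blue_strategy D b r (v, m) t) h \<beta>"
  shows "T * richman D b r w k < money (v, m) (h @ [(\<beta>, q, w)]) Blue"
proof -
  let ?d = "richman_bid D b r k u"
  have "T * ?d \<le> T * richman D b r u (Suc k)"
    using richman_bid_bounds(2)[OF u(1-3)] T by (rule mult_left_mono)
  then have bid: "\<beta> Blue = T * ?d"
    using rich blue_bid u(4) k by (simp add: blue_strategy_def T_def)
  show ?thesis
  proof (cases q)
    case Blue
    then have "w = arg_min_on (\<lambda>w. richman D b r w k) (succs D u)"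
      using w(2) u(4) k by (simp add: blue_strategy_def)
    then have "richman D b r w k = richman D b r u (Suc k) - ?d"
      using richman_minus_bid[OF u(2,3)] w(1) by blast
    then have "T * richman D b r w k = T * richman D b r u (Suc k) - T * ?d"
      by (simp only: right_diff_distrib)
    then show ?thesis
      using rich bid Blue by simp
  next
    case Red
    have "T * richman D b r w k \<le> T * (richman D b r u (Suc k) + ?d)"
      using richman_le_plus_bid[OF u(2,3) w(1)] T by (rule mult_left_mono)
    also have "\<dots> = T * richman D b r u (Suc k) + T * ?d"
      by (rule distrib_left)
    finally show ?thesis
      using rich bid higher Red by simp
  qed
qed

text \<open>
  Since nobody owns more than the total money, a share above the value of the vertex cannot occur
  where that value is \<open>1\<close>.
\<close>
lemma richman_less_1_of_rich:
  assumes h: "legal_history D b r (v, m) h" and m: "\<And>p. 0 \<le> m p" "0 < m Blue + m Red"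
    and "(m Blue + m Red) * richman D b r u k < money (v, m) h Blue"
  shows "richman D b r u k < 1"
proof -
  have "(m Blue + m Red) * richman D b r u k < (m Blue + m Red) * 1"
    using assms(4) money_total[OF h] money_nonneg[OF h m(1), of Red] by simp
  then show ?thesis
    using m(2) by (simp only: mult_less_cancel_left_pos)
qed

text \<open>
  The length of the history is tracked because the strategy counts turns by it; it equals the
  number of rounds only as long as the game is not over.
\<close>
lemma winning_share_along_play:
  fixes c :: "nat \<Rightarrow> player"
  assumes v: "v \<in> pverts D" and m: "\<And>p. 0 \<le> m p" "0 < m Blue + m Red"
    and rich: "(m Blue + m Red) * richman D b r v t < m Blue"
    and \<tau>: "legal_strategy D b r (v, m) Red \<tau>"
    and "n \<le> t"
  defines "\<sigma> \<equiv> (\<lambda>_. \<tau>)(Blue := blue_strategy D b r (v, m) t)"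
  defines "h \<equiv> play b r (v, m) \<sigma> c n"
  shows "token (v, m) h = b \<or>
         length h = n \<and>
         (m Blue + m Red) * richman D b r (token (v, m) h) (t - n) < money (v, m) h Blue"
  using \<open>n \<le> t\<close> unfolding h_def
proof (induction n)
  case 0
  then show ?case using rich by simp
next
  case (Suc n)
  let ?T = "m Blue + m Red"
  define h where "h = play b r (v, m) \<sigma> c n"
  define \<beta> where "\<beta> = (\<lambda>p. bid (\<sigma> p) h)"
  define q where "q = higher_bidder \<beta> (c n)"
  define w where "w = move (\<sigma> q) h \<beta>"
  let ?u = "token (v, m) h"
  have step: "play b r (v, m) \<sigma> c (Suc n) =
                (if game_over b r (v, m) h then h else h @ [(\<beta>, q, w)])"
    by (simp add: h_def \<beta>_def q_def w_def Let_def)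
  have legal: "legal_strategy D b r (v, m) p (\<sigma> p)" for p
    using legal_blue_strategy[OF v m(1)] \<tau> by (cases p) (auto simp: \<sigma>_def)
  have h: "legal_history D b r (v, m) h"
    unfolding h_def using legal by (rule legal_play)
  show ?case
  proof (cases "?u = b")
    case True
    then show ?thesis
      unfolding step by (simp add: game_over_def)
  next
    case False
    then have IH: "length h = n" "?T * richman D b r ?u (Suc (t - Suc n)) < money (v, m) h Blue"
      using Suc by (auto simp: h_def Suc_diff_Suc simp del: richman.simps)
    have "richman D b r ?u (Suc (t - Suc n)) < 1"
      using h m IH(2) by (rule richman_less_1_of_rich)
    then have u_r: "?u \<noteq> r"
      using False by auto
    then have running: "\<not> game_over b r (v, m) h"
      using False by (simp add: game_over_def)
    have "?T * richman D b r w (t - Suc n) < money (v, m) (h @ [(\<beta>, q, w)]) Blue"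
    proof (rule winning_share_preserved[where u = ?u and t = t])
      show "?u \<in> pverts D"
        using token_in_pverts[OF h v] .
      show "\<beta> Blue = bid (blue_strategy D b r (v, m) t) h"
        by (simp add: \<beta>_def \<sigma>_def)
      show "\<beta> Blue \<le> \<beta> q"
        unfolding q_def by (rule bid_le_higher_bidder)
      show "w \<in> succs D ?u"
        using legal[of q] h running by (simp add: w_def legal_strategy_def)
      show "w = move (blue_strategy D b r (v, m) t) h \<beta>" if "q = Blue"
        using that by (simp add: w_def \<sigma>_def)
    qed (use False u_r IH m(2) in simp_all)
    then show ?thesis
      unfolding step using running IH(1) by simp
  qed
qed

lemma winning_within:
  assumes v: "v \<in> pverts D" and m: "\<And>p. 0 \<le> m p" "0 < m Blue + m Red"
    and rich: "richman D b r v t < money_share m Blue"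
  shows "winning_strategy_within D b r (v, m) Blue t (blue_strategy D b r (v, m) t)"
  unfolding winning_strategy_within_def opponent.simps
proof (intro conjI allI impI)
  show legal: "legal_strategy D b r (v, m) Blue (blue_strategy D b r (v, m) t)"
    using legal_blue_strategy[OF v m(1)] .
  fix \<tau> :: "'v strategy" and c
  assume \<tau>: "legal_strategy D b r (v, m) Red \<tau>"
  let ?\<sigma> = "(\<lambda>_. \<tau>)(Blue := blue_strategy D b r (v, m) t)"
  let ?h = "play b r (v, m) ?\<sigma> c t"
  have "legal_strategy D b r (v, m) p (?\<sigma> p)" for p
    using legal \<tau> by (cases p) auto
  then have h: "legal_history D b r (v, m) ?h"
    by (rule legal_play)
  have "(m Blue + m Red) * richman D b r v t < m Blue"
    using rich m(2) by (simp add: money_share_def field_simps)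
  from winning_share_along_play[OF v m this \<tau> order_refl, of c]
  have "token (v, m) ?h = b"
  proof (elim disjE conjE)
    assume "(m Blue + m Red) * richman D b r (token (v, m) ?h) (t - t) < money (v, m) ?h Blue"
    from richman_less_1_of_rich[OF h m this] show ?thesis
      by (simp split: if_splits)
  qed
  then show "\<exists>n\<le>t. token (v, m) (play b r (v, m) ?\<sigma> c n) = goal b r Blue"
    by (auto simp: goal_def)
qed

end

section \<open>Winning from a share above the limit\<close>

theorem theorem2:
  fixes D :: "'v pair_pre_digraph" and b r v :: 'v and m :: "player \<Rightarrow> real"
  assumes "pair_fin_digraph D"
    and "b \<in> pverts D" and "r \<in> pverts D" and "b \<noteq> r"
    and "\<And>u. u \<in> pverts D \<Longrightarrow> u \<rightarrow>\<^sup>*\<^bsub>with_proj D\<^esub> b \<or> u \<rightarrow>\<^sup>*\<^bsub>with_proj D\<^esub> r"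
    and "v \<in> pverts D"
    and "\<And>p. 0 \<le> m p" and "0 < m Blue + m Red"
  shows "(money_share m Blue > richman_limit D b r v \<longrightarrow>
            (\<exists>\<sigma>. winning_strategy D b r (v, m) Blue \<sigma>)) \<and>
         (\<forall>t. money_share m Blue > richman D b r v t \<longrightarrow>
            (\<exists>\<sigma>. winning_strategy_within D b r (v, m) Blue t \<sigma>))"
proof -
  interpret richman_graph D b r
    using assms(1,5) by (rule richman_graph.intro)
  have within: "\<exists>\<sigma>. winning_strategy_within D b r (v, m) Blue t \<sigma>"
    if "richman D b r v t < money_share m Blue" for t
    using winning_within[OF assms(6-8) that] by blast
  moreover have "\<exists>\<sigma>. winning_strategy D b r (v, m) Blue \<sigma>"
    if "richman_limit D b r v < money_share m Blue"
  proof -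
    have "\<forall>\<^sub>F t in sequentially. richman D b r v t < money_share m Blue"
      using richman_tendsto_limit[OF assms(1,5,6)] that by (rule order_tendstoD(2))
    then obtain t where "richman D b r v t < money_share m Blue"
      by (auto simp: eventually_sequentially)
    from within[OF this] show ?thesis
      by (auto intro: winning_strategy_within_imp_winning_strategy)
  qed
  ultimately show ?thesis by blast
qed

end
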